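(* Let $G$ be a topological group acting on $\mathcal{X}^n$, let $\{\mathbf{P}_g\}_{g\in G}$ and $\{\mathbf{Q}_g\}_{g\in G}$ be two families of probability distributions on $\mathcal{X}^n$, and let $M_n=m_n(X^n)$ be any maximally invariant statistic under the action of $G$ on $\mathcal{X}^n$. Assume that $G$ is amenable, that the following three properties hold: (1) as topological spaces, $G$ and $\mathcal{X}^n$ are Polish and locally compact (separable, completely metrizable and locally compact), equipped with their Borel $\sigma$-algebras; (2) the action of $G$ on $\mathcal{X}^n$ is free, continuous and proper; (3) the models $\{\mathbf{P}_g\}_{g\in G}$ and $\{\mathbf{Q}_g\}_{g\in G}$ are invariant and have densities $p_g,q_g$ with respect to a common measure $\mu$ on $\mathcal{X}^n$ that is relatively left invariant with some multiplier $\chi$, and all densities have a single common support; and that there is $\varepsilon>0$ such that $$\mathbf{E}^{\mathbf{Q}}_1\left[\left|\ln\frac{q_1(X^n)}{p_1(X^n)}\right|^{1+\varepsilon}\right]<\infty\quad\text{and}\quad \mathbf{E}^{\mathbf{Q}^{M_n}}\left[\left|\ln\frac{q^{M_n}(M_n)}{p^{M_n}(M_n)}\right|^{1+\varepsilon}\right]<\infty,$$ where the subindex $1$ refers to the unit element of $G$. Then the likelihood ratio $$T^{M_n}=\frac{q^{M_n}(m_n(X^n))}{p^{M_n}(m_n(X^n))}$$ is a GROW e-statistic for testing $\mathcal{H}_0: X^n\sim\mathbf{P}_g,\ g\in G$ against $\mathcal{H}_1: X^n\sim\mathbf{Q}_g,\ g\in G$.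
   Context: $G$ acts on the observation space $\mathcal{X}$ and on $\mathcal{X}^n$ componentwise, $g(x_1,\dots,x_n)=(gx_1,\dots,gx_n)$. $X^n=(X_1,\dots,X_n)$ is the data, with values in $\mathcal{X}^n$; $\mathbf{E}^{\mathbf{P}}_g,\mathbf{E}^{\mathbf{Q}}_g$ are the expectations when $X^n$ has distribution $\mathbf{P}_g$, $\mathbf{Q}_g$. Statistics are measurable functions of the data, with values in any set equipped with a $\sigma$-algebra. Invariance: $\{\mathbf{P}_g\}_{g\in G}$ is invariant if $\mathbf{P}_{hg}\{X^n\in hB\}=\mathbf{P}_g\{X^n\in B\}$ for all $g,h\in G$ and measurable $B\subseteq\mathcal{X}^n$; similarly for $\{\mathbf{Q}_g\}$. Relatively left invariant with multiplier $\chi$: $\mu\{gB\}=\chi(g)\mu\{B\}$ for any measurable $B\subseteq\mathcal{X}^n$ and $g\in G$. Single common support: the densities $p_g,q_g$ are positive on one and the same set. Free action: $gx=x$ for some $x$ implies $g$ is the identity. Proper action: the map $(g,x)\mapsto(gx,x)$ from $G\times\mathcal{X}^n$ to $\mathcal{X}^n\times\mathcal{X}^n$ has compact preimages of compact sets. Maximally invariant: $m_n(x)=m_n(x')$ if and only if there is $g\in G$ with $x=gx'$. By invariance of the models, the distribution of $M_n$ under $\mathbf{P}_g$ (resp. $\mathbf{Q}_g$) does not depend on $g$; it is denoted $\mathbf{P}^{M_n}$ (resp. $\mathbf{Q}^{M_n}$), with density $p^{M_n}$ (resp. $q^{M_n}$) with respect to a common dominating measure. Amenability: $G$ is amenable if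 there is a sequence $\mathbf{\Pi}_1,\mathbf{\Pi}_2,\dots$ of probability distributions on $G$ such that $\lim_{k\to\infty}|\mathbf{\Pi}_k\{B\}-\mathbf{\Pi}_k\{Bg\}|=0$ for every measurable $B\subseteq G$ and every $g\in G$. E-statistic: a real-valued statistic $T_n=t_n(X^n)\ge 0$ with $\sup_{g\in G}\mathbf{E}^{\mathbf{P}}_g[T_n]\le 1$. GROW: an e-statistic is GROW if it maximizes $T_n\mapsto\inf_{g\in G}\mathbf{E}^{\mathbf{Q}}_g[\ln T_n]$ over all e-statistics.
   Formalization: The σ-algebra on the range of the maximally invariant statistic is assumed rich enough that every G-invariant Borel set is a preimage under m_n of a measurable set; with a too coarse (e.g. trivial) σ-algebra the claim is false. *)

theory Defs
  imports "HOL-Probability.Probability"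
begin

(* Groups are written additively, following the library class topological_group_add.
   This class does NOT assume commutativity: "g + h" is the group product gh and "0" is
   the unit element. *)

(* The n-fold power of the observation space is the function type 'n => 'x over a finite
   index type 'n, with its product topology and Borel sigma-algebra. *)

definition left_action :: "('g::group_add \<Rightarrow> 'y \<Rightarrow> 'y) \<Rightarrow> bool" where
  "left_action act \<longleftrightarrow>
     (\<forall>x. act 0 x = x) \<and> (\<forall>g h x. act (g + h) x = act g (act h x))"

definition componentwise :: "('g \<Rightarrow> 'x \<Rightarrow> 'x) \<Rightarrow> 'g \<Rightarrow> ('n \<Rightarrow> 'x) \<Rightarrow> ('n \<Rightarrow> 'x)" where
  "componentwise act g x = (\<lambda>i. act g (x i))"

definition free_action :: "('g::group_add \<Rightarrow> 'y \<Rightarrow> 'y) \<Rightarrow> bool" where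
  "free_action act \<longleftrightarrow> (\<forall>g x. act g x = x \<longrightarrow> g = 0)"

definition continuous_action ::
    "('g::topological_space \<Rightarrow> 'y::topological_space \<Rightarrow> 'y) \<Rightarrow> bool" where
  "continuous_action act \<longleftrightarrow> continuous_on UNIV (\<lambda>(g, x). act g x)"

definition proper_action ::
    "('g::topological_space \<Rightarrow> 'y::topological_space \<Rightarrow> 'y) \<Rightarrow> bool" where
  "proper_action act \<longleftrightarrow>
     (\<forall>K. compact K \<longrightarrow> compact ((\<lambda>(g, x). (act g x, x)) -` K))"

definition amenable :: "'g::topological_group_add itself \<Rightarrow> bool" where
  "amenable _ \<longleftrightarrow>
     (\<exists>R :: nat \<Rightarrow> 'g measure.
        (\<forall>k. prob_space (R k) \<and> sets (R k) = sets borel) \<and>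
        (\<forall>B\<in>sets borel. \<forall>g.
           (\<lambda>k. \<bar>measure (R k) B - measure (R k) ((\<lambda>b. b + g) ` B)\<bar>) \<longlonglongrightarrow> 0))"

definition distribution_family :: "('g \<Rightarrow> 'y::topological_space measure) \<Rightarrow> bool" where
  "distribution_family P \<longleftrightarrow> (\<forall>g. prob_space (P g) \<and> sets (P g) = sets borel)"

definition invariant_model ::
    "('g::group_add \<Rightarrow> 'y::topological_space \<Rightarrow> 'y) \<Rightarrow> ('g \<Rightarrow> 'y measure) \<Rightarrow> bool" where
  "invariant_model act P \<longleftrightarrow>
     (\<forall>g h. \<forall>B\<in>sets borel. measure (P (h + g)) (act h ` B) = measure (P g) B)"

definition relatively_left_invariant ::
    "('g \<Rightarrow> 'y::topological_space \<Rightarrow> 'y) \<Rightarrow> ('g \<Rightarrow> real) \<Rightarrow> 'y measure \<Rightarrow> bool" where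
  "relatively_left_invariant act c \<mu> \<longleftrightarrow>
     (\<forall>g. 0 < c g) \<and>
     (\<forall>g. \<forall>B\<in>sets borel. emeasure \<mu> (act g ` B) = ennreal (c g) * emeasure \<mu> B)"

definition has_density :: "'y measure \<Rightarrow> 'y measure \<Rightarrow> ('y \<Rightarrow> real) \<Rightarrow> bool" where
  "has_density N \<mu> f \<longleftrightarrow>
     f \<in> borel_measurable \<mu> \<and> (\<forall>x\<in>space \<mu>. 0 \<le> f x) \<and> N = density \<mu> (\<lambda>x. ennreal (f x))"

definition single_common_support ::
    "('g \<Rightarrow> 'y \<Rightarrow> real) \<Rightarrow> ('g \<Rightarrow> 'y \<Rightarrow> real) \<Rightarrow> bool" where
  "single_common_support p q \<longleftrightarrow>
     (\<exists>S. \<forall>g. {x. 0 < p g x} = S \<and> {x. 0 < q g x} = S)"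

definition maximally_invariant :: "('g \<Rightarrow> 'y \<Rightarrow> 'y) \<Rightarrow> ('y \<Rightarrow> 'm) \<Rightarrow> bool" where
  "maximally_invariant act m \<longleftrightarrow> (\<forall>x x'. m x = m x' \<longleftrightarrow> (\<exists>g. x = act g x'))"

(* The sigma-algebra on the range of a maximally invariant statistic is arbitrary, except that
   it must not be too coarse: every invariant Borel event has to be an event about the
   statistic.  (With the trivial sigma-algebra {{}, space M} every map is a measurable statistic
   and the likelihood ratio of its distributions is constantly 1.)  For a measurable maximally
   invariant statistic with values in a standard Borel space, on a Polish sample space, the
   condition always holds, by Blackwell's theorem. *)
definition carries_invariant_events ::
    "('g \<Rightarrow> 'y::topological_space \<Rightarrow> 'y) \<Rightarrow> ('y \<Rightarrow> 'm) \<Rightarrow> 'm measure \<Rightarrow> bool" where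
  "carries_invariant_events act m M \<longleftrightarrow>
     (\<forall>B\<in>sets borel. (\<forall>g. act g ` B = B) \<longrightarrow> (\<exists>C\<in>sets M. B = m -` C))"

(* The library's real logarithm has the value 0 at 0; here the value has to be -\<infinity>. *)
definition elog :: "real \<Rightarrow> ereal" where
  "elog t = (if t \<le> 0 then -\<infinity> else ereal (ln t))"

(* Positive minus negative part (e2ennreal truncates negative values to 0).  Note
   \<infinity> - \<infinity> = \<infinity> in ereal; for the log of an e-statistic the positive part has finite
   expectation as soon as ln (q_g / p_g) is Q_g-integrable, so this case does not occur. *)
definition eexpectation :: "'y measure \<Rightarrow> ('y \<Rightarrow> ereal) \<Rightarrow> ereal" where
  "eexpectation N f =
     enn2ereal (\<integral>\<^sup>+ x. e2ennreal (f x) \<partial>N) - enn2ereal (\<integral>\<^sup>+ x. e2ennreal (- f x) \<partial>N)"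

definition e_statistic ::
    "('g \<Rightarrow> 'y::topological_space measure) \<Rightarrow> ('y \<Rightarrow> real) \<Rightarrow> bool" where
  "e_statistic P T \<longleftrightarrow>
     T \<in> borel_measurable borel \<and> (\<forall>x. 0 \<le> T x) \<and>
     (SUP g. \<integral>\<^sup>+ x. ennreal (T x) \<partial>P g) \<le> 1"

definition worst_case_growth :: "('g \<Rightarrow> 'y measure) \<Rightarrow> ('y \<Rightarrow> real) \<Rightarrow> ereal" where
  "worst_case_growth Q T = (INF g. eexpectation (Q g) (\<lambda>x. elog (T x)))"

definition GROW ::
    "('g \<Rightarrow> 'y::topological_space measure) \<Rightarrow> ('g \<Rightarrow> 'y measure) \<Rightarrow> ('y \<Rightarrow> real) \<Rightarrow> bool" where
  "GROW P Q T \<longleftrightarrow>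
     e_statistic P T \<and>
     (\<forall>S. e_statistic P S \<longrightarrow> worst_case_growth Q S \<le> worst_case_growth Q T)"

(* p and q are positive almost everywhere for the measures N this is used with, so the
   conventions x / 0 = 0 and ln 0 = 0 play no role. *)
definition finite_log_ratio_moment ::
    "'y measure \<Rightarrow> ('y \<Rightarrow> real) \<Rightarrow> ('y \<Rightarrow> real) \<Rightarrow> real \<Rightarrow> bool" where
  "finite_log_ratio_moment N q p r \<longleftrightarrow>
     (\<integral>\<^sup>+ x. ennreal (\<bar>ln (q x / p x)\<bar> powr r) \<partial>N) < \<infinity>"

end

theory Submission
  imports Defs
begin

text \<open>The likelihood ratio \<open>T\<close> of the maximal invariant is constant on orbits, so it is an e-statistic
and has the same growth \<open>K = E_Q ln T\<close> under every \<open>Q g\<close>; \<open>K\<close> is the relative entropy of the two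
distributions of the maximal invariant.  The point is that no e-statistic \<open>S\<close> has a worst-case growth
above \<open>K\<close>.  The argument is of Hunt--Stein type: \<open>S\<close> is replaced by an invariant statistic that is
nearly as good, and invariant statistics are functions of the maximal invariant, for which the bound \<open>K\<close>
is Gibbs' inequality (\<open>expected_log_le\<close>).

By invariance of the models, the distribution of \<open>S\<close> under \<open>P g\<close> or \<open>Q g\<close> is that of \<open>x \<mapsto> S (g x)\<close>
under \<open>P 0\<close> or \<open>Q 0\<close>, so that only two measures occur.  First, \<open>S\<close> is truncated from above and shifted
away from zero, so that \<open>F = ln (min S N + \<delta>)\<close> is bounded.  The growth lost is small uniformly in \<open>g\<close>,
because \<open>ln S\<close> is the sum of \<open>ln (q / p)\<close>, which is integrable, and the logarithm of a variable with
expectation at most one (\<open>uniform_truncation\<close>).  Next, the averages of \<open>F (g x)\<close> over the probability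
measures that witness amenability become invariant in the limit, lose nothing in expectation under
\<open>Q 0\<close> by Fubini's theorem, and their exponentials keep their bound under \<open>P 0\<close> by Jensen's inequality.

The averages themselves need not converge.  The minimal-norm argument behind Mazur's lemma,
\<open>convergent_choice_midpoint_convex\<close>, yields elements with the same bounds that converge almost
everywhere.  Since asymptotic invariance holds at every point, the pointwise limit is exactly
invariant (\<open>invariant_limit_of_averages\<close>) and factors through the maximal invariant
(\<open>invariant_function_factors\<close>).\<close>

section \<open>Growth of a statistic as an integral of its logarithm\<close>

lemma elog_measurable [measurable (raw)]:
  assumes [measurable]: "W \<in> borel_measurable N"
  shows "(\<lambda>x. elog (W x)) \<in> borel_measurable N"
  unfolding elog_def by measurable

lemma eexpectation_elog_eq_integral:
  assumes [measurable]: "W \<in> borel_measurable N"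
    and pos: "AE x in N. 0 < W x" and int: "integrable N (\<lambda>x. ln (W x))"
  shows "eexpectation N (\<lambda>x. elog (W x)) = ereal (\<integral>x. ln (W x) \<partial>N)"
proof -
  have p: "(\<integral>\<^sup>+x. e2ennreal (elog (W x)) \<partial>N) = (\<integral>\<^sup>+x. ennreal (ln (W x)) \<partial>N)"
    using pos by (intro nn_integral_cong_AE) (auto simp: elog_def)
  have n: "(\<integral>\<^sup>+x. e2ennreal (- elog (W x)) \<partial>N) = (\<integral>\<^sup>+x. ennreal (- ln (W x)) \<partial>N)"
    using pos by (intro nn_integral_cong_AE) (auto simp: elog_def)
  have fin: "(\<integral>\<^sup>+x. ennreal (ln (W x)) \<partial>N) \<noteq> \<infinity>" "(\<integral>\<^sup>+x. ennreal (- ln (W x)) \<partial>N) \<noteq> \<infinity>"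
    using int unfolding real_integrable_def by auto
  have enn: "enn2ereal t = ereal (enn2real t)" if "t \<noteq> \<infinity>" for t
    using that by (cases t) auto
  show ?thesis
    unfolding eexpectation_def p n real_lebesgue_integral_def[OF int] enn[OF fin(1)] enn[OF fin(2)]
    by simp
qed

text \<open>Once the positive part of the logarithm is integrable, a finite lower bound for the growth forces the negative
part to be integrable as well, since otherwise the growth would be \<open>- \<infinity>\<close>; in particular the statistic is
almost surely positive, and the growth is an ordinary integral.\<close>

lemma eexpectation_elog_bounded_below:
  assumes [measurable]: "W \<in> borel_measurable N"
    and pos: "(\<integral>\<^sup>+x. e2ennreal (elog (W x)) \<partial>N) < \<infinity>"
    and a: "ereal a \<le> eexpectation N (\<lambda>x. elog (W x))"
  shows "AE x in N. 0 < W x" "integrable N (\<lambda>x. ln (W x))" "a \<le> (\<integral>x. ln (W x) \<partial>N)"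
proof -
  have [measurable]: "(\<lambda>x. elog (W x)) \<in> borel_measurable N" by measurable
  have neg: "(\<integral>\<^sup>+x. e2ennreal (- elog (W x)) \<partial>N) \<noteq> \<infinity>"
  proof
    assume "(\<integral>\<^sup>+x. e2ennreal (- elog (W x)) \<partial>N) = \<infinity>"
    then have "eexpectation N (\<lambda>x. elog (W x)) = - \<infinity>"
      unfolding eexpectation_def using pos
      by (cases "\<integral>\<^sup>+x. e2ennreal (elog (W x)) \<partial>N") auto
    then show False using a by simp
  qed
  have "AE x in N. e2ennreal (- elog (W x)) \<noteq> \<infinity>"
    by (rule nn_integral_PInf_AE[OF _ neg]) measurable
  then show AE_pos: "AE x in N. 0 < W x"
    by (rule AE_mp) (auto simp: elog_def not_less)
  have "(\<integral>\<^sup>+x. e2ennreal (elog (W x)) \<partial>N) = (\<integral>\<^sup>+x. ennreal (ln (W x)) \<partial>N)"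
    "(\<integral>\<^sup>+x. e2ennreal (- elog (W x)) \<partial>N) = (\<integral>\<^sup>+x. ennreal (- ln (W x)) \<partial>N)"
    using AE_pos by (auto intro!: nn_integral_cong_AE simp: elog_def)
  then show int: "integrable N (\<lambda>x. ln (W x))"
    using pos neg unfolding real_integrable_def by auto
  show "a \<le> (\<integral>x. ln (W x) \<partial>N)"
    using a eexpectation_elog_eq_integral[OF assms(1) AE_pos int] by simp
qed

section \<open>Likelihood ratios and Gibbs' inequality\<close>

lemma has_density_AE_iff:
  assumes "has_density N \<mu> f"
  shows "(AE x in N. A x) \<longleftrightarrow> (AE x in \<mu>. 0 < f x \<longrightarrow> A x)"
  using assms unfolding has_density_def by (auto simp: AE_density)

lemma has_density_sets: "has_density N \<mu> f \<Longrightarrow> sets N = sets \<mu>"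
  unfolding has_density_def by simp

text \<open>Multiplying by \<open>p / q\<close> changes the measure from \<open>Q\<close> to \<open>P\<close>.  Only an inequality holds in general,
because the part of \<open>P\<close> that lives on \<open>{q = 0}\<close> is lost.\<close>

lemma nn_integral_inverse_ratio_le:
  assumes P: "has_density P \<mu> p" and Q: "has_density Q \<mu> q"
    and [measurable]: "W \<in> borel_measurable \<mu>" and W: "\<And>x. 0 \<le> W x"
  shows "(\<integral>\<^sup>+x. ennreal (W x * (p x / q x)) \<partial>Q) \<le> (\<integral>\<^sup>+x. ennreal (W x) \<partial>P)"
proof -
  have [measurable]: "p \<in> borel_measurable \<mu>" "q \<in> borel_measurable \<mu>"
    and p: "\<And>x. x \<in> space \<mu> \<Longrightarrow> 0 \<le> p x" and q: "\<And>x. x \<in> space \<mu> \<Longrightarrow> 0 \<le> q x"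
    and eq: "P = density \<mu> (\<lambda>x. ennreal (p x))" "Q = density \<mu> (\<lambda>x. ennreal (q x))"
    using P Q unfolding has_density_def by auto
  have "(\<integral>\<^sup>+x. ennreal (W x * (p x / q x)) \<partial>Q)
      = (\<integral>\<^sup>+x. ennreal (q x) * ennreal (W x * (p x / q x)) \<partial>\<mu>)"
    unfolding eq by (rule nn_integral_density) auto
  also have "\<dots> \<le> (\<integral>\<^sup>+x. ennreal (p x) * ennreal (W x) \<partial>\<mu>)"
  proof (rule nn_integral_mono)
    fix x assume x: "x \<in> space \<mu>"
    show "ennreal (q x) * ennreal (W x * (p x / q x)) \<le> ennreal (p x) * ennreal (W x)"
      using p[OF x] q[OF x] W[of x]
      by (cases "q x = 0") (auto simp: ennreal_mult[symmetric] mult.commute)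
  qed
  also have "\<dots> = (\<integral>\<^sup>+x. ennreal (W x) \<partial>P)"
    unfolding eq by (rule nn_integral_density[symmetric]) auto
  finally show ?thesis .
qed

lemma integrable_log_ratio:
  assumes "finite_measure N" and [measurable]: "p \<in> borel_measurable N" "q \<in> borel_measurable N"
    and "0 < \<epsilon>" and fin: "finite_log_ratio_moment N q p (1 + \<epsilon>)"
  shows "integrable N (\<lambda>x. ln (q x / p x))"
proof -
  interpret finite_measure N by fact
  have le: "\<bar>t\<bar> \<le> 1 + \<bar>t\<bar> powr (1 + \<epsilon>)" for t :: real
  proof (cases "\<bar>t\<bar> \<le> 1")
    case False
    then have "\<bar>t\<bar> powr 1 \<le> \<bar>t\<bar> powr (1 + \<epsilon>)" using \<open>0 < \<epsilon>\<close> by (intro powr_mono) auto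
    then show ?thesis using False by simp
  qed (simp add: add_increasing2)
  have "integrable N (\<lambda>x. \<bar>ln (q x / p x)\<bar> powr (1 + \<epsilon>))"
    using fin unfolding finite_log_ratio_moment_def by (intro integrableI_bounded) auto
  then have "integrable N (\<lambda>x. 1 + \<bar>ln (q x / p x)\<bar> powr (1 + \<epsilon>))" by simp
  then show ?thesis by (rule Bochner_Integration.integrable_bound) (use le in auto)
qed

text \<open>Gibbs' inequality in the variational form of Donsker and Varadhan: apply \<open>ln z \<le> z - 1\<close> to
\<open>z = exp \<psi> * (p / q) / b\<close>, whose expectation under \<open>Q\<close> is at most one by the change of measure.\<close>

lemma expected_log_le:
  assumes P: "has_density P \<mu> p" and Q: "has_density Q \<mu> q" and "prob_space Q"
    and pos: "AE x in Q. 0 < p x"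
    and int_log: "integrable Q (\<lambda>x. ln (q x / p x))"
    and int: "integrable Q \<psi>" and exp_le: "(\<integral>\<^sup>+x. ennreal (exp (\<psi> x)) \<partial>P) \<le> ennreal b" and "0 < b"
  shows "(\<integral>x. \<psi> x \<partial>Q) \<le> (\<integral>x. ln (q x / p x) \<partial>Q) + ln b"
proof -
  interpret prob_space Q by fact
  have [measurable_cong]: "sets Q = sets \<mu>" using Q by (rule has_density_sets)
  have [measurable]: "p \<in> borel_measurable \<mu>" "q \<in> borel_measurable \<mu>"
    using P Q unfolding has_density_def by auto
  have [measurable]: "\<psi> \<in> borel_measurable \<mu>" using int by (auto dest: borel_measurable_integrable)
  have qpos: "AE x in Q. 0 < q x" using has_density_AE_iff[OF Q] by simp
  define Z where "Z x = exp (\<psi> x) * (p x / q x)" for x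
  have "(\<integral>\<^sup>+x. ennreal (Z x) \<partial>Q) \<le> ennreal b"
    using nn_integral_inverse_ratio_le[OF P Q, of "\<lambda>x. exp (\<psi> x)"] exp_le by (simp add: Z_def)
  moreover have Zpos: "AE x in Q. 0 \<le> Z x" using pos qpos by eventually_elim (simp add: Z_def)
  moreover have [measurable]: "Z \<in> borel_measurable \<mu>" unfolding Z_def by measurable
  ultimately have Z: "integrable Q Z" "(\<integral>x. Z x \<partial>Q) \<le> b"
    using \<open>0 < b\<close> by (auto intro!: integrableI_nonneg integral_real_bounded simp: le_less_trans)
  have "AE x in Q. \<psi> x \<le> ln (q x / p x) + ln b + Z x / b - 1"
    using pos qpos
  proof eventually_elim
    case (elim x)
    then have "ln (Z x / b) \<le> Z x / b - 1" using \<open>0 < b\<close> by (intro ln_le_minus_one) (simp add: Z_def)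
    moreover have "ln (Z x / b) = \<psi> x - ln (q x / p x) - ln b"
      using elim \<open>0 < b\<close> by (simp add: Z_def ln_mult ln_div)
    ultimately show ?case by simp
  qed
  then have "(\<integral>x. \<psi> x \<partial>Q) \<le> (\<integral>x. ln (q x / p x) + ln b + Z x / b - 1 \<partial>Q)"
    using int int_log Z by (intro integral_mono_AE) auto
  also have "\<dots> = (\<integral>x. ln (q x / p x) \<partial>Q) + ln b + (\<integral>x. Z x \<partial>Q) / b - 1"
    using int_log Z(1) by (simp add: prob_space)
  also have "\<dots> \<le> (\<integral>x. ln (q x / p x) \<partial>Q) + ln b"
    using Z(2) \<open>0 < b\<close> by (simp add: field_simps)
  finally show ?thesis .
qed

section \<open>Truncation of e-statistics\<close>

text \<open>The truncation level \<open>N\<close> is chosen before \<open>W\<close>, so that it serves all translates of an e-statistic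
at once.  This is possible because \<open>ln W = ln V + ln (q / p)\<close> with \<open>V = W * (p / q)\<close>: the second summand is a
fixed integrable function, and the upper tail of \<open>ln V\<close> is controlled by the expectation of \<open>V\<close>
under \<open>Q\<close>, which is at most one.\<close>

lemma uniform_truncation:
  assumes P: "has_density P \<mu> p" and Q: "has_density Q \<mu> q" and "prob_space Q"
    and pos: "AE x in Q. 0 < p x"
    and int_log: "integrable Q (\<lambda>x. ln (q x / p x))" and "0 < \<eta>"
  obtains N where "0 < N" and "\<And>W a \<delta>. W \<in> borel_measurable \<mu> \<Longrightarrow> (\<And>x. 0 \<le> W x) \<Longrightarrow>
    (\<integral>\<^sup>+x. ennreal (W x) \<partial>P) \<le> 1 \<Longrightarrow> ereal a \<le> eexpectation Q (\<lambda>x. elog (W x)) \<Longrightarrow> 0 < \<delta> \<Longrightarrow>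
    a - \<eta> \<le> (\<integral>x. ln (min (W x) N + \<delta>) \<partial>Q)"
proof -
  interpret prob_space Q by fact
  have [measurable_cong]: "sets Q = sets \<mu>" using Q by (rule has_density_sets)
  have [measurable]: "p \<in> borel_measurable \<mu>" "q \<in> borel_measurable \<mu>"
    using P Q unfolding has_density_def by auto
  have qpos: "AE x in Q. 0 < q x" using has_density_AE_iff[OF Q] by simp
  define L where "L x = ln (q x / p x)" for x
  have [measurable]: "L \<in> borel_measurable \<mu>" unfolding L_def by measurable
  have intL: "integrable Q L" using int_log unfolding L_def .
  define tail where "tail b x = max (\<bar>L x\<bar> - b) 0" for b x
  have [measurable]: "tail b \<in> borel_measurable \<mu>" for b unfolding tail_def by measurable
  have int_tail: "integrable Q (tail b)" if "0 \<le> b" for b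
    using that by (intro Bochner_Integration.integrable_bound[OF intL]) (auto simp: tail_def)
  have "(\<lambda>n. \<integral>x. tail (real n) x \<partial>Q) \<longlonglongrightarrow> (\<integral>x. 0 \<partial>Q)"
  proof (rule integral_dominated_convergence[where w="\<lambda>x. \<bar>L x\<bar>"])
    show "AE x in Q. (\<lambda>n. tail (real n) x) \<longlonglongrightarrow> 0"
    proof (rule AE_I2)
      fix x
      have "eventually (\<lambda>n. tail (real n) x = 0) sequentially"
        using eventually_ge_at_top[of "nat \<lceil>\<bar>L x\<bar>\<rceil>"]
      proof eventually_elim
        case (elim n)
        then have "\<bar>L x\<bar> \<le> real n" by (simp add: nat_le_iff ceiling_le_iff)
        then show ?case by (simp add: tail_def)
      qed
      then show "(\<lambda>n. tail (real n) x) \<longlonglongrightarrow> 0" by (rule tendsto_eventually)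
    qed
  qed (use intL in \<open>auto simp: tail_def\<close>)
  moreover have "(\<lambda>n. exp (- real n)) \<longlonglongrightarrow> 0" by real_asymp
  ultimately have "(\<lambda>n. exp (- real n) + (\<integral>x. tail (real n) x \<partial>Q)) \<longlonglongrightarrow> 0 + 0"
    by (intro tendsto_add) auto
  then have "eventually (\<lambda>n. exp (- real n) + (\<integral>x. tail (real n) x \<partial>Q) < \<eta>) sequentially"
    using \<open>0 < \<eta>\<close> by (intro order_tendstoD(2)) auto
  then obtain n where n: "exp (- real n) + (\<integral>x. tail (real n) x \<partial>Q) < \<eta>"
    by (auto simp: eventually_sequentially)
  define b where "b = real n"
  show ?thesis
  proof
    (* The truncation level is N = exp (2 * b). *)
    show "0 < exp (2 * b)" by simp
    fix W a and \<delta> :: real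
    assume [measurable]: "W \<in> borel_measurable \<mu>" and W: "\<And>x. 0 \<le> W x"
      and W_P: "(\<integral>\<^sup>+x. ennreal (W x) \<partial>P) \<le> 1"
      and a: "ereal a \<le> eexpectation Q (\<lambda>x. elog (W x))" and "0 < \<delta>"
    define V where "V x = W x * (p x / q x)" for x
    have [measurable]: "V \<in> borel_measurable \<mu>" unfolding V_def by measurable
    have V_nn: "(\<integral>\<^sup>+x. ennreal (V x) \<partial>Q) \<le> 1"
      using nn_integral_inverse_ratio_le[OF P Q, of W] W W_P by (simp add: V_def)
    have V_pos: "AE x in Q. 0 \<le> V x" using pos qpos by eventually_elim (simp add: V_def W)
    have V: "integrable Q V" "(\<integral>x. V x \<partial>Q) \<le> 1"
      using V_nn V_pos by (auto intro!: integrableI_nonneg integral_real_bounded simp: le_less_trans)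
    have ln_W: "ln (W x) = ln (V x) + L x" if "0 < W x" "0 < p x" "0 < q x" for x
      using that by (simp add: V_def L_def ln_mult ln_div)
    have "(\<integral>\<^sup>+x. e2ennreal (elog (W x)) \<partial>Q) \<le> (\<integral>\<^sup>+x. ennreal (V x + \<bar>L x\<bar>) \<partial>Q)"
      using pos qpos
    proof (intro nn_integral_mono_AE, eventually_elim)
      case (elim x)
      show ?case
      proof (cases "W x \<le> 0")
        case False
        then have "0 < V x" using elim by (simp add: V_def)
        then have "ln (W x) \<le> V x + \<bar>L x\<bar>" using ln_W[of x] ln_less_self[of "V x"] elim False by linarith
        then show ?thesis using False by (simp add: elog_def ennreal_leI)
      qed (simp add: elog_def e2ennreal_neg)
    qed
    also have "\<dots> < \<infinity>"
    proof -
      have "integrable Q (\<lambda>x. V x + \<bar>L x\<bar>)" using V intL by auto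
      then show ?thesis unfolding real_integrable_def by (simp add: less_top)
    qed
    finally have fin: "(\<integral>\<^sup>+x. e2ennreal (elog (W x)) \<partial>Q) < \<infinity>" .
    have WQ: "W \<in> borel_measurable Q" by measurable
    note W_ln = eexpectation_elog_bounded_below[OF WQ fin a]
    have int_min: "integrable Q (\<lambda>x. ln (min (W x) (exp (2 * b)) + \<delta>))"
    proof (rule integrable_const_bound)
      have "\<bar>ln (min (W x) (exp (2 * b)) + \<delta>)\<bar> \<le> \<bar>ln \<delta>\<bar> + \<bar>ln (exp (2 * b) + \<delta>)\<bar>" for x
      proof -
        have "ln \<delta> \<le> ln (min (W x) (exp (2 * b)) + \<delta>)"
          using W[of x] \<open>0 < \<delta>\<close> by (intro ln_mono) auto
        moreover have "ln (min (W x) (exp (2 * b)) + \<delta>) \<le> ln (exp (2 * b) + \<delta>)"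
          using W[of x] \<open>0 < \<delta>\<close> by (intro ln_mono) (auto simp: add_nonneg_pos)
        ultimately show ?thesis by linarith
      qed
      then show "AE x in Q. norm (ln (min (W x) (exp (2 * b)) + \<delta>)) \<le> \<bar>ln \<delta>\<bar> + \<bar>ln (exp (2 * b) + \<delta>)\<bar>"
        by simp
    qed measurable
    (* Above the threshold, 2 b is split evenly between the summands of ln W = ln V + L: the excess
       of ln V over b is at most exp (- b) V, and that of L is the tail. *)
    have "AE x in Q. ln (W x) \<le> ln (min (W x) (exp (2 * b)) + \<delta>) + exp (- b) * V x + tail b x"
      using pos qpos W_ln(1)
    proof eventually_elim
      case (elim x)
      have V0: "0 < V x" using elim by (simp add: V_def)
      show ?case
      proof (cases "W x \<le> exp (2 * b)")
        case True
        have "ln (W x) \<le> ln (W x + \<delta>)" using elim \<open>0 < \<delta>\<close> by (intro ln_mono) auto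
        moreover have "0 \<le> exp (- b) * V x" "0 \<le> tail b x" using V0 by (auto simp: tail_def)
        ultimately show ?thesis using True by (simp add: min_def)
      next
        case False
        have "2 * b \<le> ln (exp (2 * b) + \<delta>)" using \<open>0 < \<delta>\<close>
          by (metis add_pos_pos exp_gt_zero less_add_same_cancel1 less_imp_le ln_exp ln_less_cancel_iff)
        moreover have "ln (V x) - b \<le> exp (- b) * V x"
          using ln_less_self[of "exp (- b) * V x"] ln_mult_pos[OF exp_gt_zero V0, of "- b"] V0
          by simp
        moreover have "L x - b \<le> tail b x" by (simp add: tail_def)
        ultimately show ?thesis using False ln_W[of x] elim by (simp add: min_def)
      qed
    qed
    then have "(\<integral>x. ln (W x) \<partial>Q)
        \<le> (\<integral>x. ln (min (W x) (exp (2 * b)) + \<delta>) + exp (- b) * V x + tail b x \<partial>Q)"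
      using W_ln(2) int_min V int_tail[of b] by (intro integral_mono_AE) (auto simp: b_def)
    also have "\<dots> = (\<integral>x. ln (min (W x) (exp (2 * b)) + \<delta>) \<partial>Q) + exp (- b) * (\<integral>x. V x \<partial>Q)
        + (\<integral>x. tail b x \<partial>Q)"
      using int_min V(1) int_tail[of b] by (simp add: b_def)
    finally have "a \<le> (\<integral>x. ln (min (W x) (exp (2 * b)) + \<delta>) \<partial>Q) + exp (- b) * (\<integral>x. V x \<partial>Q)
        + (\<integral>x. tail b x \<partial>Q)" using W_ln(3) by linarith
    moreover have "exp (- b) * (\<integral>x. V x \<partial>Q) \<le> exp (- b)" using V(2) by simp
    ultimately show "a - \<eta> \<le> (\<integral>x. ln (min (W x) (exp (2 * b)) + \<delta>) \<partial>Q)"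
      using n unfolding b_def by linarith
  qed
qed

section \<open>Averaging over an amenable group\<close>

text \<open>Asymptotic invariance passes from events to bounded functions, since such a function is uniformly
close to a combination of finitely many indicators.\<close>

lemma amenable_average_asymptotically_invariant:
  fixes R :: "nat \<Rightarrow> 'g::topological_group_add measure" and u :: "'g \<Rightarrow> real"
  assumes prob: "\<And>k. prob_space (R k)" and sets: "\<And>k. sets (R k) = sets borel"
    and transl: "\<And>B g. B \<in> sets borel \<Longrightarrow>
      (\<lambda>k. \<bar>measure (R k) B - measure (R k) ((\<lambda>b. b + g) ` B)\<bar>) \<longlonglongrightarrow> 0"
    and u [measurable]: "u \<in> borel_measurable borel" and bound: "\<And>b. \<bar>u b\<bar> \<le> C"
  shows "(\<lambda>k. (\<integral>b. u (b + h) \<partial>R k) - (\<integral>b. u b \<partial>R k)) \<longlonglongrightarrow> 0"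
proof (rule LIMSEQ_I)
  fix e :: real assume "0 < e"
  note sets [measurable_cong]
  obtain n where n: "inverse (real (Suc n)) < e / 4"
    using reals_Archimedean[of "e / 4"] \<open>0 < e\<close> by auto
  (* Rounding u down to multiples of 1 / N leaves a step function v with finitely many level sets B j. *)
  define N where "N = real (Suc n)"
  have N: "0 < N" "inverse N < e / 4" using n by (auto simp: N_def)
  define J where "J = {\<lfloor>- (N * C)\<rfloor>..\<lfloor>N * C\<rfloor>}"
  define v where "v b = of_int \<lfloor>N * u b\<rfloor> / N" for b
  define B where "B j = {b. \<lfloor>N * u b\<rfloor> = j}" for j
  have [measurable]: "B j \<in> sets borel" for j unfolding B_def by measurable
  have [measurable]: "(\<lambda>b. b + h) \<in> borel \<rightarrow>\<^sub>M borel"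
    by (intro borel_measurable_continuous_onI continuous_intros)
  have shift: "(\<lambda>b. b + h) -` A = (\<lambda>b. b + (- h)) ` A" for A :: "'g set"
  proof (intro equalityI subsetI)
    fix b assume "b \<in> (\<lambda>b. b + h) -` A"
    then show "b \<in> (\<lambda>b. b + (- h)) ` A" by (intro image_eqI[of _ _ "b + h"]) (auto simp: add.assoc)
  qed (auto simp: add.assoc)
  have v_sum: "v b = (\<Sum>j\<in>J. of_int j / N * indicator (B j) b)" for b
  proof -
    have "N * \<bar>u b\<bar> \<le> N * C" using bound[of b] N by (intro mult_left_mono) auto
    then have "\<bar>N * u b\<bar> \<le> N * C" using N by (simp add: abs_mult)
    then have "\<lfloor>N * u b\<rfloor> \<in> J" unfolding J_def by (auto intro!: floor_mono simp: abs_le_iff)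
    moreover have "finite J" by (simp add: J_def)
    moreover have "of_int j / N * indicator (B j) b = (if \<lfloor>N * u b\<rfloor> = j then v b else 0)" for j
      by (simp add: v_def B_def)
    ultimately show ?thesis by simp
  qed
  have [measurable]: "v \<in> borel_measurable borel" unfolding v_def by measurable
  have v_close: "\<bar>v b - u b\<bar> \<le> inverse N" for b
  proof -
    have "\<bar>of_int \<lfloor>N * u b\<rfloor> - N * u b\<bar> \<le> 1" by linarith
    then have "\<bar>of_int \<lfloor>N * u b\<rfloor> - N * u b\<bar> / N \<le> 1 / N" using N by (intro divide_right_mono) auto
    moreover have "v b - u b = (of_int \<lfloor>N * u b\<rfloor> - N * u b) / N" using N by (simp add: v_def field_simps)
    ultimately show ?thesis using N by (simp add: inverse_eq_divide)
  qed
  have C: "0 \<le> C" using bound[of 0] by linarith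
  have v_bound: "\<bar>v b\<bar> \<le> C + inverse N" for b using v_close[of b] bound[of b] by linarith
  have diff: "(\<integral>b. v (b + h) \<partial>R k) - (\<integral>b. v b \<partial>R k)
      = (\<Sum>j\<in>J. of_int j / N * (measure (R k) ((\<lambda>b. b + (- h)) ` B j) - measure (R k) (B j)))" for k
  proof -
    interpret prob_space "R k" by (rule prob)
    have sp: "space (R k) = UNIV" using sets_eq_imp_space_eq[OF sets] by simp
    have ev: "B j \<in> sets (R k)" "(\<lambda>b. b + (- h)) ` B j \<in> sets (R k)" for j
      using measurable_sets[of "\<lambda>b. b + h" borel borel "B j"] sets by (auto simp: shift)
    have ind: "indicator (B j) (b + h) = (indicator ((\<lambda>b. b + (- h)) ` B j) b :: real)" for j b
      unfolding shift[symmetric] by (simp add: indicator_def)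
    show ?thesis
      unfolding v_sum ind using ev
      by (subst (1 2) Bochner_Integration.integral_sum)
         (auto simp: sum_subtractf[symmetric] right_diff_distrib sp less_top[symmetric] emeasure_eq_measure)
  qed
  have "(\<lambda>k. measure (R k) ((\<lambda>b. b + (- h)) ` B j) - measure (R k) (B j)) \<longlonglongrightarrow> 0" for j
    using transl[of "B j" "- h"] by (subst tendsto_rabs_zero_iff[symmetric]) (simp add: abs_minus_commute)
  then have "(\<lambda>k. (\<integral>b. v (b + h) \<partial>R k) - (\<integral>b. v b \<partial>R k)) \<longlonglongrightarrow> 0"
    unfolding diff by (intro tendsto_null_sum tendsto_mult_right_zero)
  then obtain K where K: "\<And>k. k \<ge> K \<Longrightarrow> \<bar>(\<integral>b. v (b + h) \<partial>R k) - (\<integral>b. v b \<partial>R k)\<bar> < e / 2"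
    using LIMSEQ_D[of _ 0 "e / 2"] \<open>0 < e\<close> by fastforce
  have approx: "\<bar>(\<integral>b. v (t b) \<partial>R k) - (\<integral>b. u (t b) \<partial>R k)\<bar> \<le> inverse N"
    if [measurable]: "t \<in> borel \<rightarrow>\<^sub>M borel" for t k
  proof -
    interpret prob_space "R k" by (rule prob)
    have iu: "integrable (R k) (\<lambda>b. u (t b))"
      using bound by (intro integrable_const_bound[where B=C]) auto
    have iv: "integrable (R k) (\<lambda>b. v (t b))"
      using v_bound by (intro integrable_const_bound[where B="C + inverse N"]) auto
    have "\<bar>(\<integral>b. v (t b) \<partial>R k) - (\<integral>b. u (t b) \<partial>R k)\<bar> = \<bar>\<integral>b. v (t b) - u (t b) \<partial>R k\<bar>"
      using iu iv by simp
    also have "\<dots> \<le> (\<integral>b. \<bar>v (t b) - u (t b)\<bar> \<partial>R k)" by (rule integral_abs_bound)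
    also have "\<dots> \<le> (\<integral>b. inverse N \<partial>R k)"
      using iu iv v_close by (intro integral_mono) auto
    finally show ?thesis by (simp add: prob_space)
  qed
  have "norm ((\<integral>b. u (b + h) \<partial>R k) - (\<integral>b. u b \<partial>R k) - 0) < e" if "k \<ge> K" for k
    unfolding real_norm_def
    using K[OF that] approx[of "\<lambda>b. b + h" k, simplified] approx[of "\<lambda>b. b" k, simplified] N(2)
    by arith
  then show "\<exists>K. \<forall>k\<ge>K. norm ((\<integral>b. u (b + h) \<partial>R k) - (\<integral>b. u b \<partial>R k) - 0) < e" by blast
qed

text \<open>A form of Mazur's lemma, for sets \<open>D n\<close> that replace the convex hulls of the tails of a sequence. A
function \<open>g n\<close> of nearly minimal \<open>L\<^sup>2\<close> norm is chosen in each \<open>D n\<close>.  The minimal norms increase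
with \<open>n\<close> to a limit, so the parallelogram identity makes the choices a Cauchy sequence, and a subsequence
converges almost everywhere.\<close>

lemma (in prob_space) convergent_choice_midpoint_convex:
  fixes D :: "nat \<Rightarrow> ('a \<Rightarrow> real) set"
  assumes meas: "\<And>n f. f \<in> D n \<Longrightarrow> f \<in> borel_measurable M"
    and bound: "\<And>n f x. f \<in> D n \<Longrightarrow> \<bar>f x\<bar> \<le> C"
    and nonempty: "\<And>n. D n \<noteq> {}"
    and decreasing: "\<And>n k. n \<le> k \<Longrightarrow> D k \<subseteq> D n"
    and midpoint: "\<And>n f g. f \<in> D n \<Longrightarrow> g \<in> D n \<Longrightarrow> (\<lambda>x. (f x + g x) / 2) \<in> D n"
  obtains f where "\<And>n. f n \<in> D n" and "AE x in M. convergent (\<lambda>n. f n x)"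
proof -
  define E where "E f = (\<integral>x. (f x)\<^sup>2 \<partial>M)" for f :: "'a \<Rightarrow> real"
  define d where "d n = (INF f\<in>D n. E f)" for n
  have sq: "(f x)\<^sup>2 \<le> C\<^sup>2" if "f \<in> D n" for f n x
    using bound[OF that, of x] by (metis abs_ge_zero power_mono power2_abs)
  have int_sq: "integrable M (\<lambda>x. (f x)\<^sup>2)" if "f \<in> D n" for f n
    using meas[OF that] sq[OF that] by (intro integrable_const_bound[where B="C\<^sup>2"]) auto
  have int: "integrable M f" if "f \<in> D n" for f n
    using meas[OF that] bound[OF that] by (intro integrable_const_bound[where B=C]) auto
  have E_nonneg: "0 \<le> E f" for f by (simp add: E_def)
  have bdd: "bdd_below (E ` A)" for A using E_nonneg by (intro bdd_belowI[where m=0]) auto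
  have E_le: "E f \<le> C\<^sup>2" if "f \<in> D n" for f n
  proof -
    have "E f \<le> (\<integral>x. C\<^sup>2 \<partial>M)"
      unfolding E_def by (intro integral_mono int_sq[OF that] sq[OF that]) auto
    then show ?thesis by (simp add: prob_space)
  qed
  have d_le: "d n \<le> E f" if "f \<in> D n" for f n
    unfolding d_def using bdd that by (rule cINF_lower)
  have "incseq d"
    unfolding d_def using nonempty bdd decreasing by (intro monoI cINF_superset_mono) auto
  moreover have "d n \<le> C\<^sup>2" for n
    using nonempty[of n] d_le E_le by (metis all_not_in_conv order_trans)
  ultimately have "Cauchy d"
    using incseq_convergent LIMSEQ_imp_Cauchy by metis
  have "\<exists>f\<in>D n. E f < d n + inverse (real (Suc n))" for n
    using cINF_less_iff[OF nonempty bdd, of n "d n + inverse (real (Suc n))"]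
    unfolding d_def[symmetric] by simp
  then obtain g where g: "\<And>n. g n \<in> D n" and gd: "\<And>n. E (g n) < d n + inverse (real (Suc n))"
    by metis
  have g_in: "g k \<in> D n" if "n \<le> k" for n k
    using g decreasing[OF that] by blast
  (* Parallelogram identity; the midpoint of g n and g k still lies in D n, so that its energy is
     at least d n. *)
  have L2: "(\<integral>x. (g n x - g k x)\<^sup>2 \<partial>M) \<le> 2 * (d k - d n) + 4 * inverse (real (Suc n))"
    if "n \<le> k" for n k
  proof -
    have mid: "(\<lambda>x. (g n x + g k x) / 2) \<in> D n" (is "?h \<in> _") using g g_in[OF that] midpoint by blast
    have "(\<integral>x. (g n x - g k x)\<^sup>2 \<partial>M)
        = (\<integral>x. 2 * (g n x)\<^sup>2 + 2 * (g k x)\<^sup>2 - 4 * (?h x)\<^sup>2 \<partial>M)"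
      by (intro Bochner_Integration.integral_cong) (auto simp: power2_eq_square field_simps)
    also have "\<dots> = 2 * E (g n) + 2 * E (g k) - 4 * E ?h"
      unfolding E_def using int_sq[OF g[of n]] int_sq[OF g[of k]] int_sq[OF mid]
      by (subst Bochner_Integration.integral_diff Bochner_Integration.integral_add; simp)+
    also have "\<dots> \<le> 2 * (d k - d n) + 4 * inverse (real (Suc n))"
    proof -
      have "inverse (real (Suc k)) \<le> inverse (real (Suc n))" using that by (simp add: field_simps)
      then show ?thesis using gd[of n] gd[of k] d_le[OF mid] by argo
    qed
    finally show ?thesis .
  qed
  (* The pointwise inequality |u| <= e / 2 + u^2 / (2 e) passes from L2 to L1. *)
  have L1: "(\<integral>x. \<bar>g i x - g j x\<bar> \<partial>M) \<le> e / 2 + (\<integral>x. (g i x - g j x)\<^sup>2 \<partial>M) / (2 * e)"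
    if "0 < e" for i j and e :: real
  proof -
    have le: "\<bar>u\<bar> \<le> e / 2 + u\<^sup>2 / (2 * e)" for u
    proof -
      have "0 \<le> (\<bar>u\<bar> - e)\<^sup>2 / (2 * e)" using that by simp
      also have "\<dots> = e / 2 + u\<^sup>2 / (2 * e) - \<bar>u\<bar>"
        using that by (simp add: field_simps power2_eq_square)
      finally show ?thesis by simp
    qed
    have sq4: "(g i x - g j x)\<^sup>2 \<le> (2 * C)\<^sup>2" for x
    proof -
      have "\<bar>g i x - g j x\<bar> \<le> 2 * C" using bound[OF g[of i], of x] bound[OF g[of j], of x] by linarith
      then show ?thesis by (metis abs_ge_zero power_mono power2_abs)
    qed
    have i2: "integrable M (\<lambda>x. (g i x - g j x)\<^sup>2)"
      using sq4 meas[OF g[of i]] meas[OF g[of j]]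
      by (intro integrable_const_bound[where B="(2 * C)\<^sup>2"]) auto
    have "(\<integral>x. \<bar>g i x - g j x\<bar> \<partial>M) \<le> (\<integral>x. e / 2 + (g i x - g j x)\<^sup>2 / (2 * e) \<partial>M)"
      using int[OF g[of i]] int[OF g[of j]] i2 le by (intro integral_mono) auto
    also have "\<dots> = e / 2 + (\<integral>x. (g i x - g j x)\<^sup>2 \<partial>M) / (2 * e)"
      using i2 by (simp add: prob_space)
    finally show ?thesis .
  qed
  have L1_Cauchy: "\<exists>K. \<forall>i\<ge>K. \<forall>j\<ge>K. (\<integral>x. norm (g i x - g j x) \<partial>M) < e" if e: "0 < e" for e
  proof -
    obtain K1 where K1: "\<And>i j. i \<ge> K1 \<Longrightarrow> j \<ge> K1 \<Longrightarrow> \<bar>d i - d j\<bar> < e\<^sup>2 / 4"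
      using metric_CauchyD[OF \<open>Cauchy d\<close>, of "e\<^sup>2 / 4"] e by (auto simp: dist_real_def)
    obtain K2 where K2: "inverse (real (Suc K2)) < e\<^sup>2 / 8"
      using reals_Archimedean[of "e\<^sup>2 / 8"] e by auto
    have ordered: "(\<integral>x. \<bar>g i x - g j x\<bar> \<partial>M) < e" if ij: "max K1 K2 \<le> i" "i \<le> j" for i j
    proof -
      have "inverse (real (Suc i)) \<le> inverse (real (Suc K2))" using ij by (simp add: field_simps)
      moreover have "\<bar>d j - d i\<bar> < e\<^sup>2 / 4" using K1 ij by auto
      ultimately have "(\<integral>x. (g i x - g j x)\<^sup>2 \<partial>M) < e\<^sup>2"
        using L2[OF ij(2)] K2 by argo
      then have "(\<integral>x. (g i x - g j x)\<^sup>2 \<partial>M) / (2 * e) < e / 2"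
        using e by (simp add: field_simps power2_eq_square)
      then show ?thesis using L1[OF e, of i j] by linarith
    qed
    have "(\<integral>x. norm (g i x - g j x) \<partial>M) < e" if "max K1 K2 \<le> i" "max K1 K2 \<le> j" for i j
      using ordered[of i j] ordered[of j i] that
      by (cases "i \<le> j") (auto simp: abs_minus_commute)
    then show ?thesis by blast
  qed
  obtain r where r: "strict_mono r" "AE x in M. Cauchy (\<lambda>i. g (r i) x)"
    by (rule cauchy_L1_AE_cauchy_subseq[OF int[OF g] L1_Cauchy])
  show ?thesis
  proof
    show "g (r n) \<in> D n" for n using g_in strict_mono_imp_increasing[OF r(1)] by blast
    show "AE x in M. convergent (\<lambda>n. g (r n) x)" using r(2) by (simp add: Cauchy_convergent_iff)
  qed
qed

text \<open>The averaging step of the Hunt--Stein argument.  Absolute continuity carries the almost-everywhere convergence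
over from \<open>Q\<close> to \<open>P\<close>; uniform boundedness lets both integral bounds pass to the limit.\<close>

lemma invariant_limit_of_averages:
  fixes act :: "'g::topological_group_add \<Rightarrow> 'y::topological_space \<Rightarrow> 'y" and F :: "'y \<Rightarrow> real"
  assumes amen: "amenable TYPE('g)" and act: "left_action act"
    and act_meas [measurable]: "(\<lambda>(g, x). act g x) \<in> borel \<Otimes>\<^sub>M borel \<rightarrow>\<^sub>M borel"
    and "prob_space P" "prob_space Q" and sets_P: "sets P = sets borel" and sets_Q: "sets Q = sets borel"
    and ac: "absolutely_continuous Q P"
    and F [measurable]: "F \<in> borel_measurable borel" and bound: "\<And>x. \<bar>F x\<bar> \<le> C"
    and lower: "\<And>g. a \<le> (\<integral>x. F (act g x) \<partial>Q)"
    and upper: "\<And>g. (\<integral>x. exp (F (act g x)) \<partial>P) \<le> b"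
  obtains \<phi> where "\<phi> \<in> borel_measurable borel" "\<And>g x. \<phi> (act g x) = \<phi> x"
    and "integrable Q \<phi>" "a \<le> (\<integral>x. \<phi> x \<partial>Q)"
    and "integrable P (\<lambda>x. exp (\<phi> x))" "(\<integral>x. exp (\<phi> x) \<partial>P) \<le> b"
proof -
  interpret P: prob_space P by fact
  interpret Q: prob_space Q by fact
  obtain R :: "nat \<Rightarrow> 'g measure" where R: "\<And>k. prob_space (R k)" and sets_R: "\<And>k. sets (R k) = sets borel"
    and transl: "\<And>B g. B \<in> sets borel \<Longrightarrow>
      (\<lambda>k. \<bar>measure (R k) B - measure (R k) ((\<lambda>b. b + g) ` B)\<bar>) \<longlonglongrightarrow> 0"
    using amen unfolding amenable_def by blast
  note sets_P [measurable_cong] sets_Q [measurable_cong] sets_R [measurable_cong]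
  have [measurable]: "(\<lambda>g. act g x) \<in> borel \<rightarrow>\<^sub>M borel" for x
    using measurable_compose[OF _ act_meas, of "\<lambda>g. (g, x)" borel] by simp
  have [measurable]: "(\<lambda>x. act g x) \<in> borel \<rightarrow>\<^sub>M borel" for g
    using measurable_compose[OF _ act_meas, of "\<lambda>x. (g, x)" borel] by simp
  define G where "G k x = (\<integral>g. F (act g x) \<partial>R k)" for k x
  have G_meas: "G k \<in> borel_measurable borel" for k
  proof -
    interpret R: prob_space "R k" by (rule R)
    show ?thesis unfolding G_def by measurable
  qed
  have expF_le: "exp (F x) \<le> exp C" for x using bound[of x] by simp
  have int_R: "integrable (R k) (\<lambda>g. F (act g x))" "integrable (R k) (\<lambda>g. exp (F (act g x)))" for k x
  proof -
    interpret R: prob_space "R k" by (rule R)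
    show "integrable (R k) (\<lambda>g. F (act g x))"
      using bound by (intro R.integrable_const_bound[where B=C]) auto
    show "integrable (R k) (\<lambda>g. exp (F (act g x)))"
      using expF_le by (intro R.integrable_const_bound[where B="exp C"]) auto
  qed
  have G_bound: "\<bar>G k x\<bar> \<le> C" for k x
  proof -
    interpret R: prob_space "R k" by (rule R)
    have "\<bar>G k x\<bar> \<le> (\<integral>g. \<bar>F (act g x)\<bar> \<partial>R k)" unfolding G_def by (rule integral_abs_bound)
    also have "\<dots> \<le> (\<integral>g. C \<partial>R k)" using int_R(1) bound by (intro integral_mono) auto
    finally show ?thesis by (simp add: R.prob_space)
  qed
  have G_lower: "a \<le> (\<integral>x. G k x \<partial>Q)" for k
  proof -
    interpret R: prob_space "R k" by (rule R)
    interpret RQ: pair_prob_space "R k" Q ..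
    have int: "integrable (R k \<Otimes>\<^sub>M Q) (\<lambda>(g, x). F (act g x))"
      using bound by (intro RQ.integrable_const_bound[where B=C]) (auto simp: split_beta)
    have "a = (\<integral>g. a \<partial>R k)" by (simp add: R.prob_space)
    also have "\<dots> \<le> (\<integral>g. (\<integral>x. F (act g x) \<partial>Q) \<partial>R k)"
      using RQ.integrable_fst[OF int] lower by (intro integral_mono) auto
    also have "\<dots> = (\<integral>x. G k x \<partial>Q)" unfolding G_def by (rule RQ.Fubini_integral[OF int, symmetric])
    finally show ?thesis .
  qed
  have G_upper: "(\<integral>x. exp (G k x) \<partial>P) \<le> b" for k
  proof -
    interpret R: prob_space "R k" by (rule R)
    interpret RP: pair_prob_space "R k" P ..
    have int: "integrable (R k \<Otimes>\<^sub>M P) (\<lambda>(g, x). exp (F (act g x)))"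
      using expF_le by (intro RP.integrable_const_bound[where B="exp C"]) (auto simp: split_beta)
    have jensen: "exp (G k x) \<le> (\<integral>g. exp (F (act g x)) \<partial>R k)" for x
      unfolding G_def using int_R[of k x]
      by (intro R.jensens_inequality[where I=UNIV]) (auto simp: exp_convex)
    have "integrable P (\<lambda>x. exp (G k x))"
      using G_meas[of k] G_bound[of k] by (intro P.integrable_const_bound[where B="exp C"]) (auto simp: abs_le_iff)
    then have "(\<integral>x. exp (G k x) \<partial>P) \<le> (\<integral>x. (\<integral>g. exp (F (act g x)) \<partial>R k) \<partial>P)"
      using RP.integrable_snd[OF int] jensen by (intro integral_mono) auto
    also have "\<dots> = (\<integral>g. (\<integral>x. exp (F (act g x)) \<partial>P) \<partial>R k)" by (rule RP.Fubini_integral[OF int])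
    also have "\<dots> \<le> (\<integral>g. b \<partial>R k)"
      using RP.integrable_fst[OF int] upper by (intro integral_mono) auto
    finally show ?thesis by (simp add: R.prob_space)
  qed
  have G_inv: "(\<lambda>k. G k (act h x) - G k x) \<longlonglongrightarrow> 0" for h x
  proof -
    have "act g (act h x) = act (g + h) x" for g using act by (simp add: left_action_def)
    then show ?thesis unfolding G_def
      using amenable_average_asymptotically_invariant[OF R sets_R transl, of "\<lambda>g. F (act g x)" C h] bound
      by simp
  qed
  (* Everything that has to survive is put into D n: the two integral bounds, and the fact that a
     member is as close to being invariant as the averages from the n-th on.  All of these are
     preserved by midpoints, the bound on the exponential because exp is convex. *)
  define D where "D n = {f. f \<in> borel_measurable borel \<and> (\<forall>x. \<bar>f x\<bar> \<le> C) \<and> a \<le> (\<integral>x. f x \<partial>Q)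
      \<and> (\<integral>x. exp (f x) \<partial>P) \<le> b
      \<and> (\<forall>h x e. (\<forall>k\<ge>n. \<bar>G k (act h x) - G k x\<bar> \<le> e) \<longrightarrow> \<bar>f (act h x) - f x\<bar> \<le> e)}" for n
  have int_Q: "integrable Q f" and int_exp: "integrable P (\<lambda>x. exp (f x))"
    if [measurable]: "f \<in> borel_measurable borel" and b: "\<And>x. \<bar>f x\<bar> \<le> C" for f
  proof -
    show "integrable Q f" using b by (intro Q.integrable_const_bound[where B=C]) auto
    show "integrable P (\<lambda>x. exp (f x))"
      using b by (intro P.integrable_const_bound[where B="exp C"]) (auto simp: abs_le_iff)
  qed
  have D_mid: "(\<lambda>x. (f x + g x) / 2) \<in> D n" if f: "f \<in> D n" and g: "g \<in> D n" for n f g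
  proof -
    have [measurable]: "f \<in> borel_measurable borel" "g \<in> borel_measurable borel"
      and fC: "\<And>x. \<bar>f x\<bar> \<le> C" and gC: "\<And>x. \<bar>g x\<bar> \<le> C"
      using f g by (auto simp: D_def)
    have C: "\<bar>(f x + g x) / 2\<bar> \<le> C" for x using fC[of x] gC[of x] unfolding abs_le_iff by (auto simp: field_simps)
    have int_Q_f: "integrable Q f" and int_Q_g: "integrable Q g"
      by (rule int_Q; use fC gC in simp)+
    have int_exp_f: "integrable P (\<lambda>x. exp (f x))" and int_exp_g: "integrable P (\<lambda>x. exp (g x))"
      by (rule int_exp; use fC gC in simp)+
    have int_exp_mid: "integrable P (\<lambda>x. exp ((f x + g x) / 2))"
      by (rule int_exp) (use C in simp_all)
    have "exp ((f x + g x) / 2) \<le> (exp (f x) + exp (g x)) / 2" for x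
      using convex_onD[OF exp_convex, of "1/2" "f x" "g x"] by (simp add: field_simps)
    then have "(\<integral>x. exp ((f x + g x) / 2) \<partial>P) \<le> (\<integral>x. (exp (f x) + exp (g x)) / 2 \<partial>P)"
      using int_exp_f int_exp_g int_exp_mid by (intro integral_mono) auto
    also have "\<dots> = ((\<integral>x. exp (f x) \<partial>P) + (\<integral>x. exp (g x) \<partial>P)) / 2"
      using int_exp_f int_exp_g by simp
    also have "\<dots> \<le> b" using f g by (simp add: D_def)
    finally have "(\<integral>x. exp ((f x + g x) / 2) \<partial>P) \<le> b" .
    moreover {
      have "a \<le> ((\<integral>x. f x \<partial>Q) + (\<integral>x. g x \<partial>Q)) / 2" using f g by (simp add: D_def)
      then have "a \<le> (\<integral>x. (f x + g x) / 2 \<partial>Q)" using int_Q_f int_Q_g by simp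
    }
    moreover have "\<bar>(f (act h x) + g (act h x)) / 2 - (f x + g x) / 2\<bar> \<le> e"
      if "\<forall>k\<ge>n. \<bar>G k (act h x) - G k x\<bar> \<le> e" for h x e
    proof -
      have "\<bar>f (act h x) - f x\<bar> \<le> e" "\<bar>g (act h x) - g x\<bar> \<le> e" using f g that by (auto simp: D_def)
      then show ?thesis unfolding abs_le_iff by (auto simp: field_simps)
    qed
    ultimately show ?thesis using C by (simp add: D_def)
  qed
  obtain f where f: "\<And>n. f n \<in> D n" and conv: "AE x in Q. convergent (\<lambda>n. f n x)"
  proof (rule Q.convergent_choice_midpoint_convex[of D C])
    show "D n \<noteq> {}" for n
      using G_meas[of n] G_bound[of n] G_lower[of n] G_upper[of n] by (auto simp: D_def)
    show "D k \<subseteq> D n" if "n \<le> k" for n k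
    proof
      fix u assume u: "u \<in> D k"
      have "\<forall>j\<ge>k. \<bar>G j (act h x) - G j x\<bar> \<le> e" if "\<forall>j\<ge>n. \<bar>G j (act h x) - G j x\<bar> \<le> e" for h x e
        using that \<open>n \<le> k\<close> by simp
      then show "u \<in> D n" using u unfolding D_def by simp
    qed
    show "u \<in> borel_measurable Q" if "u \<in> D n" for u n
      using that unfolding D_def measurable_cong_sets[OF sets_Q refl] by simp
  qed (use D_mid in \<open>auto simp: D_def\<close>)
  have [measurable]: "f n \<in> borel_measurable borel" and fC: "\<bar>f n x\<bar> \<le> C"
    and f_lower: "a \<le> (\<integral>x. f n x \<partial>Q)" and f_upper: "(\<integral>x. exp (f n x) \<partial>P) \<le> b" for n x
    using f[of n] by (auto simp: D_def)
  have f_inv: "(\<lambda>n. f n (act h x) - f n x) \<longlonglongrightarrow> 0" for h x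
  proof (rule LIMSEQ_I)
    fix e :: real assume "0 < e"
    then obtain K where K: "\<forall>k\<ge>K. norm (G k (act h x) - G k x - 0) < e / 2"
      using LIMSEQ_D[OF G_inv, of "e / 2" h x] by auto
    have "\<bar>f n (act h x) - f n x\<bar> \<le> e / 2" if "n \<ge> K" for n
    proof -
      have "\<bar>G k (act h x) - G k x\<bar> \<le> e / 2" if "k \<ge> n" for k
        using K \<open>n \<ge> K\<close> that by (simp add: less_imp_le)
      then show ?thesis using f[of n] unfolding D_def by blast
    qed
    then show "\<exists>K. \<forall>n\<ge>K. norm (f n (act h x) - f n x - 0) < e" using \<open>0 < e\<close> by fastforce
  qed
  (* Along each orbit the sequences f n converge to the same limits or all diverge, so lim is
     invariant at every point, also where no limit exists. *)
  define \<phi> where "\<phi> x = lim (\<lambda>n. f n x)" for x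
  have [measurable]: "\<phi> \<in> borel_measurable borel" unfolding \<phi>_def by measurable
  have "(\<lambda>n. f n (act h x)) \<longlonglongrightarrow> l \<longleftrightarrow> (\<lambda>n. f n x) \<longlonglongrightarrow> l" for h x l
    using tendsto_add[OF f_inv[of h x], of "\<lambda>n. f n x" l] tendsto_diff[OF _ f_inv[of h x], of "\<lambda>n. f n (act h x)" l]
    by auto
  then have \<phi>_inv: "\<phi> (act h x) = \<phi> x" for h x unfolding \<phi>_def lim_def by simp
  have limQ: "AE x in Q. (\<lambda>n. f n x) \<longlonglongrightarrow> \<phi> x"
    using conv by eventually_elim (simp add: \<phi>_def convergent_LIMSEQ_iff)
  have limP: "AE x in P. (\<lambda>n. f n x) \<longlonglongrightarrow> \<phi> x"
    using sets_P sets_Q ac limQ by (intro absolutely_continuous_AE[of P Q]) auto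
  have Q_lim: "integrable Q \<phi>" "(\<lambda>n. \<integral>x. f n x \<partial>Q) \<longlonglongrightarrow> (\<integral>x. \<phi> x \<partial>Q)"
    using limQ fC by (auto intro!: integrable_dominated_convergence[where w="\<lambda>_. C"]
        integral_dominated_convergence[where w="\<lambda>_. C"])
  have exp_lim: "AE x in P. (\<lambda>n. exp (f n x)) \<longlonglongrightarrow> exp (\<phi> x)"
    using limP by eventually_elim (intro tendsto_exp)
  have "exp (f n x) \<le> exp C" for n x using fC[of n x] by simp
  then have P_lim: "integrable P (\<lambda>x. exp (\<phi> x))" "(\<lambda>n. \<integral>x. exp (f n x) \<partial>P) \<longlonglongrightarrow> (\<integral>x. exp (\<phi> x) \<partial>P)"
    using exp_lim by (auto intro!: integrable_dominated_convergence[where w="\<lambda>_. exp C"]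
        integral_dominated_convergence[where w="\<lambda>_. exp C"])
  show ?thesis
  proof
    show "a \<le> (\<integral>x. \<phi> x \<partial>Q)" using f_lower by (intro LIMSEQ_le_const[OF Q_lim(2)]) auto
    show "(\<integral>x. exp (\<phi> x) \<partial>P) \<le> b" using f_upper by (intro LIMSEQ_le_const2[OF P_lim(2)]) auto
  qed (use \<phi>_inv Q_lim(1) P_lim(1) in auto)
qed

section \<open>Invariant functions and the maximal invariant\<close>

text \<open>The Doob--Dynkin factorization: the sublevel sets of an invariant function are invariant events, hence
preimages \<open>m -` C t\<close>, and the value of the function is recovered from the levels \<open>t\<close> with \<open>m x \<in> C t\<close>.\<close>

lemma invariant_function_factors:
  fixes act :: "'g::group_add \<Rightarrow> 'y::topological_space \<Rightarrow> 'y" and \<phi> :: "'y \<Rightarrow> real"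
  assumes act: "left_action act" and m: "m \<in> borel \<rightarrow>\<^sub>M M" and carries: "carries_invariant_events act m M"
    and \<phi> [measurable]: "\<phi> \<in> borel_measurable borel" and inv: "\<And>g x. \<phi> (act g x) = \<phi> x"
  obtains \<psi> where "\<psi> \<in> borel_measurable M" "\<And>x. \<psi> (m x) = \<phi> x"
proof -
  have "\<exists>C\<in>sets M. {x. \<phi> x \<le> t} = m -` C" for t
  proof -
    have "act g ` {x. \<phi> x \<le> t} = {x. \<phi> x \<le> t}" for g
    proof (intro equalityI subsetI)
      fix x assume "x \<in> {x. \<phi> x \<le> t}"
      then show "x \<in> act g ` {x. \<phi> x \<le> t}"
        using act inv unfolding left_action_def
        by (intro image_eqI[of _ _ "act (- g) x"]) (auto, metis add.right_inverse)
    qed (auto simp: inv)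
    moreover have "{x. \<phi> x \<le> t} \<in> sets borel" by measurable
    ultimately show ?thesis using carries unfolding carries_invariant_events_def by blast
  qed
  then obtain C where C: "\<And>t. C t \<in> sets M" "\<And>t. {x. \<phi> x \<le> t} = m -` C t" by metis
  (* Rational thresholds make the infimum countable, hence measurable; off the range of m it may be
     infinite, hence the detour through ereal. *)
  define \<psi> where "\<psi> y = real_of_ereal (INF t\<in>\<rat>. if y \<in> C t then ereal t else \<infinity>)" for y
  show ?thesis
  proof
    have "{y \<in> space M. y \<in> C t} \<in> sets M" for t
      using C(1)[of t] sets.sets_into_space[OF C(1)[of t]] by (metis Collect_conj_eq Collect_mem_eq inf.absorb_iff2)
    then show "\<psi> \<in> borel_measurable M" unfolding \<psi>_def using countable_rat
      by (intro borel_measurable_real_of_ereal borel_measurable_INF measurable_If) auto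
    show "\<psi> (m x) = \<phi> x" for x
    proof -
      have "m x \<in> C t \<longleftrightarrow> \<phi> x \<le> t" for t using C(2)[of t] by blast
      moreover have "(INF t\<in>\<rat>. if \<phi> x \<le> t then ereal t else \<infinity>) = ereal (\<phi> x)"
      proof (intro antisym)
        show "ereal (\<phi> x) \<le> (INF t\<in>\<rat>. if \<phi> x \<le> t then ereal t else \<infinity>)" by (intro INF_greatest) auto
        show "(INF t\<in>\<rat>. if \<phi> x \<le> t then ereal t else \<infinity>) \<le> ereal (\<phi> x)"
        proof (rule ereal_le_epsilon2)
          fix d :: real assume "0 < d"
          then obtain t where "t \<in> \<rat>" "\<phi> x < t" "t < \<phi> x + d"
            using Rats_dense_in_real[of "\<phi> x" "\<phi> x + d"] by auto
          then show "(INF t\<in>\<rat>. if \<phi> x \<le> t then ereal t else \<infinity>) \<le> ereal (\<phi> x) + ereal d"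
            by (intro INF_lower2[of t]) auto
        qed
      qed
      ultimately show ?thesis unfolding \<psi>_def by simp
    qed
  qed
qed

lemma invariant_model_eq_distr:
  fixes act :: "'g::group_add \<Rightarrow> 'y::topological_space \<Rightarrow> 'y"
  assumes act: "left_action act" and meas [measurable]: "\<And>g. act g \<in> borel \<rightarrow>\<^sub>M borel"
    and fam: "distribution_family P" and inv: "invariant_model act P"
  shows "P g = distr (P 0) borel (act g)"
proof (rule measure_eqI)
  interpret P0: prob_space "P 0" using fam by (auto simp: distribution_family_def)
  interpret Pg: prob_space "P g" using fam by (auto simp: distribution_family_def)
  have sets_P [measurable_cong]: "sets (P h) = sets borel" for h using fam by (auto simp: distribution_family_def)
  show "sets (P g) = sets (distr (P 0) borel (act g))" by (simp add: sets_P)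
  fix B assume "B \<in> sets (P g)"
  then have B: "B \<in> sets borel" by (simp add: sets_P)
  have img: "act g ` (act g -` B) = B"
  proof (intro equalityI subsetI)
    fix x assume "x \<in> B"
    then show "x \<in> act g ` (act g -` B)"
      using act unfolding left_action_def
      by (intro image_eqI[of _ _ "act (- g) x"]) (auto, (metis add.right_inverse)+)
  qed auto
  have sp: "space (P 0) = UNIV" using sets_eq_imp_space_eq[OF sets_P] by simp
  have "act g -` B \<in> sets borel" using measurable_sets[OF meas B, of g] by simp
  then have "measure (P (g + 0)) (act g ` (act g -` B)) = measure (P 0) (act g -` B)"
    using inv unfolding invariant_model_def by blast
  then have "measure (P g) B = measure (P 0) (act g -` B)" unfolding img by simp
  then show "emeasure (P g) B = emeasure (distr (P 0) borel (act g)) B"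
    using B by (simp add: emeasure_distr sp Pg.emeasure_eq_measure P0.emeasure_eq_measure)
qed

section \<open>The likelihood ratio of the maximal invariant\<close>

theorem corollary3:
  fixes act :: "'g::{topological_group_add, polish_space} \<Rightarrow> 'x::polish_space \<Rightarrow> 'x"
    and gact :: "'g \<Rightarrow> ('n::finite \<Rightarrow> 'x) \<Rightarrow> ('n \<Rightarrow> 'x)"
    and P Q :: "'g \<Rightarrow> ('n \<Rightarrow> 'x) measure"
    and p q :: "'g \<Rightarrow> ('n \<Rightarrow> 'x) \<Rightarrow> real"
    and \<mu> :: "('n \<Rightarrow> 'x) measure" and c :: "'g \<Rightarrow> real"
    and m :: "('n \<Rightarrow> 'x) \<Rightarrow> 'm" and M \<nu> :: "'m measure"
    and pM qM :: "'m \<Rightarrow> real" and \<epsilon> :: real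
  assumes "gact = componentwise act"
    and "left_action act"
    and "distribution_family P" and "distribution_family Q"
    and "m \<in> borel \<rightarrow>\<^sub>M M"
    and "maximally_invariant gact m"
    and "carries_invariant_events gact m M"
    and "amenable TYPE('g)"
    and "locally_compact_space (euclidean :: 'g topology)"
    and "locally_compact_space (euclidean :: ('n \<Rightarrow> 'x) topology)"
    and "free_action gact" and "continuous_action gact" and "proper_action gact"
    and "invariant_model gact P" and "invariant_model gact Q"
    and "sets \<mu> = sets borel" and "relatively_left_invariant gact c \<mu>"
    and "\<And>g. has_density (P g) \<mu> (p g)" and "\<And>g. has_density (Q g) \<mu> (q g)"
    and "single_common_support p q"
    and "sets \<nu> = sets M"
    and "has_density (distr (P 0) M m) \<nu> pM" and "has_density (distr (Q 0) M m) \<nu> qM"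
    and "0 < \<epsilon>"
    and "finite_log_ratio_moment (Q 0) (q 0) (p 0) (1 + \<epsilon>)"
    and "finite_log_ratio_moment (distr (Q 0) M m) qM pM (1 + \<epsilon>)"
  shows "GROW P Q (\<lambda>x. qM (m x) / pM (m x))"
proof -
  note families = assms(3,4) and m_meas [measurable] = assms(5) and max_inv = assms(6)
    and carries = assms(7) and amenable = assms(8) and cont = assms(12) and models = assms(14,15)
    and sets_\<mu> = assms(16) and dens_P = assms(18) and dens_Q = assms(19) and support = assms(20)
    and sets_\<nu> = assms(21) and dens_PM = assms(22) and dens_QM = assms(23)
    and \<epsilon>_pos = assms(24) and moment_0 = assms(25) and moment_M = assms(26)
  have act: "left_action gact"
    using assms(2) unfolding assms(1) left_action_def componentwise_def by auto
  have act_meas [measurable]: "(\<lambda>(g, x). gact g x) \<in> borel \<Otimes>\<^sub>M borel \<rightarrow>\<^sub>M borel"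
    unfolding borel_prod
    using cont unfolding continuous_action_def by (rule borel_measurable_continuous_onI)
  have act_g [measurable]: "gact g \<in> borel \<rightarrow>\<^sub>M borel" for g
    using measurable_compose[OF _ act_meas, of "\<lambda>x. (g, x)" borel] by simp
  have m_inv: "m (gact g x) = m x" for g x
    using max_inv unfolding maximally_invariant_def by blast
  have probs: "prob_space (P g)" "prob_space (Q g)"
    and sets_PQ [measurable_cong]: "sets (P g) = sets borel" "sets (Q g) = sets borel" for g
    using families unfolding distribution_family_def by auto
  interpret P0: prob_space "P 0" by (rule probs)
  interpret Q0: prob_space "Q 0" by (rule probs)
  have P_distr: "P g = distr (P 0) borel (gact g)" and Q_distr: "Q g = distr (Q 0) borel (gact g)" for g
    using invariant_model_eq_distr[OF act act_g] families models by blast+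
  (* The common support makes P 0 and Q 0 mutually absolutely continuous, so that almost-everywhere
     statements can be moved freely between them. *)
  have AE_P0_Q0: "(AE x in P 0. A x) \<longleftrightarrow> (AE x in Q 0. A x)" for A
  proof -
    have "0 < p 0 x \<longleftrightarrow> 0 < q 0 x" for x using support unfolding single_common_support_def by blast
    then show ?thesis unfolding has_density_AE_iff[OF dens_P] has_density_AE_iff[OF dens_Q] by simp
  qed
  have ac: "absolutely_continuous (Q 0) (P 0)"
  proof -
    have "N \<in> null_sets (P 0)" if "N \<in> null_sets (Q 0)" for N
    proof -
      have "N \<in> sets borel" using that sets_PQ by auto
      then show ?thesis using that AE_P0_Q0 AE_iff_null_sets[of N "P 0"] AE_iff_null_sets[of N "Q 0"] sets_PQ by auto
    qed
    then show ?thesis unfolding absolutely_continuous_def by blast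
  qed
  let ?PM = "distr (P 0) M m" and ?QM = "distr (Q 0) M m"
  have prob_QM: "prob_space ?QM" by (rule Q0.prob_space_distr) measurable
  have [measurable]: "pM \<in> borel_measurable M" "qM \<in> borel_measurable M"
    using dens_PM dens_QM measurable_cong_sets[OF sets_\<nu> refl, of borel] unfolding has_density_def by auto
  have M_nonneg: "0 \<le> pM (m x)" "0 \<le> qM (m x)" for x
  proof -
    have "m x \<in> space \<nu>"
      using measurable_space[of m borel M x] sets_eq_imp_space_eq[OF sets_\<nu>] by simp
    then show "0 \<le> pM (m x)" "0 \<le> qM (m x)" using dens_PM dens_QM unfolding has_density_def by auto
  qed
  have pM_pos: "AE y in ?QM. 0 < pM y"
  proof -
    have "AE y in ?PM. 0 < pM y" using has_density_AE_iff[OF dens_PM] by simp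
    then show ?thesis by (simp add: AE_distr_iff AE_P0_Q0)
  qed
  have qM_pos: "AE y in ?QM. 0 < qM y" using has_density_AE_iff[OF dens_QM] by simp
  have int_lnM: "integrable ?QM (\<lambda>y. ln (qM y / pM y))"
    using \<epsilon>_pos moment_M prob_QM by (intro integrable_log_ratio) (auto simp: prob_space_def)
  define T where "T x = qM (m x) / pM (m x)" for x
  have [measurable]: "T \<in> borel_measurable borel" unfolding T_def by measurable
  have T_inv: "T (gact g x) = T x" for g x by (simp add: T_def m_inv)
  define K where "K = (\<integral>y. ln (qM y / pM y) \<partial>?QM)"
  have T_growth: "worst_case_growth Q T = ereal K"
  proof -
    have "eexpectation (Q g) (\<lambda>x. elog (T x)) = ereal K" for g
    proof -
      have "eexpectation (Q g) (\<lambda>x. elog (T x)) = eexpectation (Q 0) (\<lambda>x. elog (T x))"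
        unfolding eexpectation_def Q_distr[of g] by (simp add: nn_integral_distr T_inv)
      also have "\<dots> = ereal (\<integral>x. ln (T x) \<partial>Q 0)"
      proof (rule eexpectation_elog_eq_integral)
        have "AE y in ?QM. 0 < qM y / pM y" using pM_pos qM_pos by eventually_elim simp
        then show "AE x in Q 0. 0 < T x" by (simp add: AE_distr_iff T_def)
        show "integrable (Q 0) (\<lambda>x. ln (T x))"
          using int_lnM by (simp add: integrable_distr_eq T_def)
      qed measurable
      also have "(\<integral>x. ln (T x) \<partial>Q 0) = K" unfolding K_def T_def by (simp add: integral_distr)
      finally show ?thesis .
    qed
    then show ?thesis by (simp add: worst_case_growth_def)
  qed
  have T_e: "e_statistic P T"
  proof -
    have "(\<integral>\<^sup>+x. ennreal (T x) \<partial>P g) \<le> 1" for g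
    proof -
      have "(\<integral>\<^sup>+x. ennreal (T x) \<partial>P g) = (\<integral>\<^sup>+x. ennreal (T x) \<partial>P 0)"
        unfolding P_distr[of g] by (simp add: nn_integral_distr T_inv)
      also have "\<dots> = (\<integral>\<^sup>+y. ennreal (1 * (qM y / pM y)) \<partial>?PM)" by (simp add: nn_integral_distr T_def)
      also have "\<dots> \<le> (\<integral>\<^sup>+y. ennreal 1 \<partial>?QM)"
        by (rule nn_integral_inverse_ratio_le[OF dens_QM dens_PM]) auto
      also have "\<dots> = 1" using prob_space.emeasure_space_1[OF prob_QM] by simp
      finally show ?thesis .
    qed
    then show ?thesis unfolding e_statistic_def using M_nonneg by (auto simp: T_def intro: SUP_least)
  qed
  have p0_pos: "AE x in Q 0. 0 < p 0 x"
    using has_density_AE_iff[OF dens_P[of 0]] AE_P0_Q0 by simp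
  have int_ln: "integrable (Q 0) (\<lambda>x. ln (q 0 x / p 0 x))"
  proof (rule integrable_log_ratio)
    show "p 0 \<in> borel_measurable (Q 0)" "q 0 \<in> borel_measurable (Q 0)"
      using dens_P[of 0] dens_Q[of 0] measurable_cong_sets[OF has_density_sets[OF dens_Q[of 0]] refl, of borel]
      unfolding has_density_def by auto
  qed (use \<epsilon>_pos moment_0 Q0.finite_measure_axioms in auto)
  have "worst_case_growth Q S \<le> ereal K" if S: "e_statistic P S" for S
  proof (rule ccontr)
    assume "\<not> worst_case_growth Q S \<le> ereal K"
    then obtain a where a: "ereal K < ereal a" "ereal a < worst_case_growth Q S"
      by (metis ereal_dense2 not_le)
    have [measurable]: "S \<in> borel_measurable borel" and S0: "\<And>x. 0 \<le> S x"
      and S_sup: "(SUP g. \<integral>\<^sup>+x. ennreal (S x) \<partial>P g) \<le> 1"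
      using S unfolding e_statistic_def by auto
    have S_P: "(\<integral>\<^sup>+x. ennreal (S (gact g x)) \<partial>P 0) \<le> 1" for g
    proof -
      have "(\<integral>\<^sup>+x. ennreal (S x) \<partial>P g) \<le> 1" using S_sup by (simp add: SUP_le_iff)
      then show ?thesis unfolding P_distr[of g] by (simp add: nn_integral_distr)
    qed
    have S_Q: "ereal a \<le> eexpectation (Q 0) (\<lambda>x. elog (S (gact g x)))" for g
    proof -
      have "ereal a \<le> eexpectation (Q g) (\<lambda>x. elog (S x))"
        using a(2) unfolding worst_case_growth_def by (metis INF_lower UNIV_I less_imp_le order_trans)
      then show ?thesis unfolding eexpectation_def Q_distr[of g] by (simp add: nn_integral_distr)
    qed
    (* The truncation of S loses one third of the gap a - K, and the shift that keeps the logarithm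
       bounded below loses another third; one third remains for the contradiction. *)
    define \<eta> where "\<eta> = (a - K) / 3"
    have \<eta>: "0 < \<eta>" using a(1) by (simp add: \<eta>_def)
    obtain N where N: "0 < N" and trunc: "\<And>g. a - \<eta> \<le> (\<integral>x. ln (min (S (gact g x)) N + \<eta>) \<partial>Q 0)"
    proof (rule uniform_truncation[OF dens_P[of 0] dens_Q[of 0] probs(2) p0_pos int_ln \<eta>])
      fix N assume N: "0 < N" and
        *: "\<And>W a \<delta>. W \<in> borel_measurable \<mu> \<Longrightarrow> (\<And>x. 0 \<le> W x) \<Longrightarrow>
          (\<integral>\<^sup>+x. ennreal (W x) \<partial>P 0) \<le> 1 \<Longrightarrow> ereal a \<le> eexpectation (Q 0) (\<lambda>x. elog (W x)) \<Longrightarrow> 0 < \<delta> \<Longrightarrow>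
          a - \<eta> \<le> (\<integral>x. ln (min (W x) N + \<delta>) \<partial>Q 0)"
      have "(\<lambda>x. S (gact g x)) \<in> borel_measurable \<mu>" for g
        by (subst measurable_cong_sets[OF sets_\<mu> refl]) measurable
      then have "a - \<eta> \<le> (\<integral>x. ln (min (S (gact g x)) N + \<eta>) \<partial>Q 0)" for g
        using S0 S_P S_Q \<eta> by (intro *)
      then show thesis using N by (rule that[rotated])
    qed
    define F where "F x = ln (min (S x) N + \<eta>)" for x
    have F_meas [measurable]: "F \<in> borel_measurable borel" unfolding F_def by measurable
    have exp_F: "exp (F x) = min (S x) N + \<eta>" for x
      using S0[of x] N \<eta> by (simp add: F_def add_nonneg_pos)
    have F_bound: "\<bar>F x\<bar> \<le> \<bar>ln \<eta>\<bar> + \<bar>ln (N + \<eta>)\<bar>" for x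
    proof -
      have "ln \<eta> \<le> F x" unfolding F_def using S0[of x] N \<eta> by (intro ln_mono) auto
      moreover have "F x \<le> ln (N + \<eta>)" unfolding F_def using S0[of x] N \<eta>
        by (intro ln_mono) (auto simp: add_nonneg_pos)
      ultimately show ?thesis by linarith
    qed
    have F_upper: "(\<integral>x. exp (F (gact g x)) \<partial>P 0) \<le> 1 + \<eta>" for g
    proof (rule integral_real_bounded)
      have "(\<integral>\<^sup>+x. ennreal (exp (F (gact g x))) \<partial>P 0) \<le> (\<integral>\<^sup>+x. ennreal (S (gact g x)) + ennreal \<eta> \<partial>P 0)"
        using S0 \<eta> by (intro nn_integral_mono) (auto simp: exp_F ennreal_plus[symmetric] simp del: ennreal_plus intro!: ennreal_leI)
      also have "\<dots> = (\<integral>\<^sup>+x. ennreal (S (gact g x)) \<partial>P 0) + ennreal \<eta>"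
        by (subst nn_integral_add) (auto simp: P0.emeasure_space_1)
      also have "\<dots> \<le> 1 + ennreal \<eta>" using S_P[of g] by (rule add_right_mono)
      also have "\<dots> = ennreal (1 + \<eta>)" using \<eta> by (simp add: ennreal_plus)
      finally show "(\<integral>\<^sup>+x. ennreal (exp (F (gact g x))) \<partial>P 0) \<le> ennreal (1 + \<eta>)" .
    qed (use \<eta> in auto)
    have F_lower: "a - \<eta> \<le> (\<integral>x. F (gact g x) \<partial>Q 0)" for g using trunc by (simp add: F_def)
    obtain \<phi> where \<phi>: "\<phi> \<in> borel_measurable borel" "\<And>g x. \<phi> (gact g x) = \<phi> x"
      and \<phi>_Q: "integrable (Q 0) \<phi>" "a - \<eta> \<le> (\<integral>x. \<phi> x \<partial>Q 0)"
      and \<phi>_P: "integrable (P 0) (\<lambda>x. exp (\<phi> x))" "(\<integral>x. exp (\<phi> x) \<partial>P 0) \<le> 1 + \<eta>"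
      by (rule invariant_limit_of_averages[OF amenable act act_meas probs sets_PQ ac F_meas F_bound F_lower F_upper])
         (rule that)
    obtain \<psi> where [measurable]: "\<psi> \<in> borel_measurable M" and \<psi>: "\<And>x. \<psi> (m x) = \<phi> x"
      by (rule invariant_function_factors[where \<phi>=\<phi>, OF act m_meas carries \<phi>]) (rule that)
    have "(\<integral>y. \<psi> y \<partial>?QM) \<le> K + ln (1 + \<eta>)"
      unfolding K_def
    proof (rule expected_log_le[OF dens_PM dens_QM prob_QM pM_pos int_lnM])
      show "integrable ?QM \<psi>" using \<phi>_Q by (simp add: integrable_distr_eq \<psi>)
      have "(\<integral>\<^sup>+y. ennreal (exp (\<psi> y)) \<partial>?PM) = ennreal (\<integral>x. exp (\<phi> x) \<partial>P 0)"
        using \<phi>_P(1) by (simp add: nn_integral_distr \<psi> nn_integral_eq_integral)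
      also have "\<dots> \<le> ennreal (1 + \<eta>)" using \<phi>_P(2) by (rule ennreal_leI)
      finally show "(\<integral>\<^sup>+y. ennreal (exp (\<psi> y)) \<partial>?PM) \<le> ennreal (1 + \<eta>)" .
    qed (use \<eta> in simp)
    moreover have "(\<integral>y. \<psi> y \<partial>?QM) = (\<integral>x. \<phi> x \<partial>Q 0)" by (simp add: integral_distr \<psi>)
    moreover have "ln (1 + \<eta>) \<le> \<eta>" using \<eta> by (intro ln_add_one_self_le_self) simp
    ultimately have "a - \<eta> \<le> K + \<eta>" using \<phi>_Q(2) by linarith
    then show False using \<eta> by (simp add: \<eta>_def field_simps)
  qed
  then have "GROW P Q T" unfolding GROW_def T_growth using T_e by blast
  then show ?thesis unfolding T_def .
qed

end
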